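(* Let $X$ be a locally compact Polish space, $\sigma$ a non-atomic Radon measure on $X$, $Y\in\mathcal B(X)$, and $\alpha,\beta:Y\to\mathbb R_+$ measurable functions with $\beta\in L^1_{\mathrm{loc}}(Y,\sigma)$. Let $\epsilon\in(0,e^{-1})$ and let $g:Y\times[\epsilon,\infty)\to\mathbb R_+$ be a (strictly positive) measurable function with $\int_A\int_\epsilon^\infty\frac{g(x,s)}{s}\,ds\,d\sigma(x)<\infty$ for all $A\in\mathcal B_0(Y)$. Define $$l(x,s)=\begin{cases}\beta(x)(-\log s)^{-\alpha(x)},&x\in Y,\ s\in(0,\epsilon),\\ g(x,s),&x\in Y,\ s\in[\epsilon,\infty),\\ 0,&x\notin Y,\ s\in\mathbb R_+.\end{cases}$$ Then the measure $dm(x,s)=\frac{l(x,s)}{s}\,d\sigma(x)\,ds$ satisfies the following conditions: (1) for each $x\in X$, either $l(x,s)>0$ for all $s\in\mathbb R_+$ (this holds exactly for $x\in Y$) or $l(x,s)=0$ for all $s\in\mathbb R_+$; and $\int_{A\times\mathbb R_+}l(x,s)\min\{s^{-1},1\}\,d\sigma(x)\,ds<\infty$ for all $A\in\mathcal B_0(Y)$; (2) there exist $\epsilon'>0$ and functions $l_1,l_2$ such that $l(x,s)=l_1(x,s)+l_2(x,s)$ for $x\in Y$, $s\in(0,\epsilon')$, where for each fixed $x\in Y$ the function $l_1(x,\cdot)$ is differentiable on $(0,\epsilon')$, and for each $n\in\mathbb N$ and $A\in\mathcal B_0(Y)$, $$\int_A\int_{(0,\frac{\epsilon'}n)}\sup_{u\in[\frac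 sn,sn]}\left|\frac{\partial}{\partial u}l_1(x,u)\right|ds\,d\sigma(x)<\infty,\qquad\int_A\int_{(0,\epsilon')}\frac{|l_2(x,s)|}{s}\,ds\,d\sigma(x)<\infty.$$
   Context: $\mathbb R_+=(0,\infty)$. $\mathcal B(X)$ is the Borel $\sigma$-algebra of $X$, $\mathcal B_0(X)$ is the collection of sets in $\mathcal B(X)$ with compact closure, and $\mathcal B_0(Y)$ is the collection of all $A\in\mathcal B_0(X)$ with $A\subset Y$. $L^1_{\mathrm{loc}}(Y,\sigma)$ is the space of measurable $f:Y\to\mathbb R$ with $\int_A|f|\,d\sigma<\infty$ for each $A\in\mathcal B_0(Y)$. *)

theory Defs
  imports "HOL-Analysis.Analysis"
begin

text \<open>
  Radon measures on a Hausdorff space: Borel, finite on compact sets, and inner regular with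
  respect to compact sets. On a locally compact Polish space inner regularity is automatic.
\<close>

definition radon_measure :: "'a::topological_space measure \<Rightarrow> bool" where
  "radon_measure M \<longleftrightarrow>
     sets M = sets borel \<and>
     (\<forall>K. compact K \<longrightarrow> emeasure M K < \<infinity>) \<and>
     (\<forall>B\<in>sets borel. emeasure M B = (SUP K\<in>{K. compact K \<and> K \<subseteq> B}. emeasure M K))"

definition non_atomic :: "'a measure \<Rightarrow> bool" where
  "non_atomic M \<longleftrightarrow>
     (\<forall>A\<in>sets M. emeasure M A > 0 \<longrightarrow>
        (\<exists>B\<in>sets M. B \<subseteq> A \<and> 0 < emeasure M B \<and> emeasure M B < emeasure M A))"

definition Borel0 :: "'a::topological_space set \<Rightarrow> 'a set set" where
  "Borel0 Y = {A \<in> sets borel. compact (closure A) \<and> A \<subseteq> Y}"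

text \<open>Functions on \<open>Y\<close> are represented by total functions whose values outside \<open>Y\<close> are ignored.\<close>

definition L1_loc :: "'a::topological_space set \<Rightarrow> 'a measure \<Rightarrow> ('a \<Rightarrow> real) set" where
  "L1_loc Y \<sigma> = {f \<in> borel_measurable (restrict_space borel Y).
     \<forall>A\<in>Borel0 Y. (\<integral>\<^sup>+x\<in>A. ennreal \<bar>f x\<bar> \<partial>\<sigma>) < \<infinity>}"

text \<open>The reference measure \<open>d\<sigma>(x) ds\<close> on the product of the base space with \<open>(0, \<infinity>)\<close>.\<close>

definition reference_measure :: "'a measure \<Rightarrow> ('a \<times> real) measure" where
  "reference_measure \<sigma> = \<sigma> \<Otimes>\<^sub>M restrict_space lborel {0<..}"

text \<open>
  \<open>dm(x, s) = l(x, s)/s d\<sigma>(x) ds\<close>. Measurability of \<open>l\<close> is part of the notion, since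
  \<^const>\<open>density\<close> is only meaningful for measurable densities.
\<close>

definition has_levy_density ::
    "'a measure \<Rightarrow> ('a \<times> real) measure \<Rightarrow> ('a \<Rightarrow> real \<Rightarrow> real) \<Rightarrow> bool" where
  "has_levy_density \<sigma> m l \<longleftrightarrow>
     (\<lambda>(x, s). l x s) \<in> borel_measurable (reference_measure \<sigma>) \<and>
     m = density (reference_measure \<sigma>) (\<lambda>(x, s). ennreal (l x s / s))"

definition l_fun :: "'a set \<Rightarrow> ('a \<Rightarrow> real) \<Rightarrow> ('a \<Rightarrow> real) \<Rightarrow> real \<Rightarrow> ('a \<Rightarrow> real \<Rightarrow> real) \<Rightarrow>
    'a \<Rightarrow> real \<Rightarrow> real" where
  "l_fun Y \<alpha> \<beta> \<epsilon> g x s =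
     (if x \<in> Y \<and> 0 < s \<and> s < \<epsilon> then \<beta> x * (- ln s) powr (- \<alpha> x)
      else if x \<in> Y \<and> \<epsilon> \<le> s then g x s
      else 0)"

definition condition1 ::
    "'a::topological_space measure \<Rightarrow> 'a set \<Rightarrow> ('a \<Rightarrow> real \<Rightarrow> real) \<Rightarrow> bool" where
  "condition1 \<sigma> Y l \<longleftrightarrow>
     (\<forall>x. (\<forall>s>0. l x s > 0) \<or> (\<forall>s>0. l x s = 0)) \<and>
     (\<forall>x. (\<forall>s>0. l x s > 0) \<longleftrightarrow> x \<in> Y) \<and>
     (\<forall>A\<in>Borel0 Y.
        (\<integral>\<^sup>+p\<in>A \<times> {0<..}. ennreal (l (fst p) (snd p) * min (1 / snd p) 1) \<partial>reference_measure \<sigma>)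
          < \<infinity>)"

text \<open>
  The supremum is taken in \<^typ>\<open>ennreal\<close>, so that it is \<open>\<infinity>\<close> if the derivative is unbounded.
  The measurability clauses say that the integrals below are integrals of measurable functions;
  \<^const>\<open>nn_integral\<close> is defined for all functions.
\<close>

definition condition2 ::
    "'a::topological_space measure \<Rightarrow> 'a set \<Rightarrow> ('a \<Rightarrow> real \<Rightarrow> real) \<Rightarrow> bool" where
  "condition2 \<sigma> Y l \<longleftrightarrow>
     (\<exists>\<epsilon>'>0. \<exists>l1 l2 :: 'a \<Rightarrow> real \<Rightarrow> real.
        (\<lambda>(x, s). l1 x s) \<in> borel_measurable (restrict_space borel (Y \<times> {0<..<\<epsilon>'})) \<and>
        (\<lambda>(x, s). l2 x s) \<in> borel_measurable (restrict_space borel (Y \<times> {0<..<\<epsilon>'})) \<and>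
        (\<forall>x\<in>Y. \<forall>s\<in>{0<..<\<epsilon>'}. l x s = l1 x s + l2 x s) \<and>
        (\<forall>x\<in>Y. l1 x differentiable_on {0<..<\<epsilon>'}) \<and>
        (\<forall>n::nat. n \<ge> 1 \<longrightarrow>
           (\<lambda>(x, s). SUP u\<in>{s / real n..s * real n}. ennreal \<bar>deriv (l1 x) u\<bar>)
             \<in> borel_measurable (restrict_space borel (Y \<times> {0<..<\<epsilon>' / real n})) \<and>
           (\<forall>A\<in>Borel0 Y.
              (\<integral>\<^sup>+x\<in>A. (\<integral>\<^sup>+s\<in>{0<..<\<epsilon>' / real n}.
                 (SUP u\<in>{s / real n..s * real n}. ennreal \<bar>deriv (l1 x) u\<bar>) \<partial>lborel) \<partial>\<sigma>) < \<infinity>)) \<and>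
        (\<forall>A\<in>Borel0 Y.
           (\<integral>\<^sup>+x\<in>A. (\<integral>\<^sup>+s\<in>{0<..<\<epsilon>'}. ennreal (\<bar>l2 x s\<bar> / s) \<partial>lborel) \<partial>\<sigma>) < \<infinity>))"

end

theory Submission
  imports Defs
begin

text \<open>
  Everything rests on the antiderivative \<open>(- ln (c * s)) powr (- a)\<close> of
  \<open>a * (- ln (c * s)) powr (- a - 1) / s\<close>, which tends to \<open>0\<close> as \<open>s\<close> decreases to \<open>0\<close>.
  Near \<open>0\<close> the density \<open>l\<close> is differentiable in \<open>s\<close>, so one may take \<open>\<epsilon>' = \<epsilon>\<close>, the explicit
  formula \<open>\<beta> x * (- ln s) powr (- \<alpha> x)\<close> for \<open>l1\<close>, and \<open>l2 = 0\<close>. What condition (2) asks for is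
  then an integral of the supremum of \<open>\<bar>deriv (l1 x) u\<bar>\<close> over \<open>u \<in> {s / n..s * n}\<close>.

  This derivative is a product of two factors that are monotone in opposite directions:
  \<open>(- ln u) powr (- \<alpha> x - 1)\<close> grows with \<open>u\<close> and is largest at \<open>u = n * s\<close>, while \<open>1 / u\<close> is
  largest at \<open>u = s / n\<close>. Bounding each factor separately
  (\<open>powr_neg_ln_dilation_bound\<close>) leaves
  \<open>n * \<beta> x * \<alpha> x * (- ln (n * s)) powr (- \<alpha> x - 1) / s\<close>, whose integral over \<open>0 < s < \<epsilon> / n\<close>
  is exactly \<open>n * \<beta> x * (- ln \<epsilon>) powr (- \<alpha> x)\<close> by the antiderivative
  (\<open>nn_integral_powr_neg_ln\<close>). Since \<open>\<epsilon> < exp (-1)\<close> makes \<open>- ln \<epsilon> > 1\<close>, this is at most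
  \<open>n * \<beta> x\<close>: the bound is uniform in \<open>\<alpha>\<close>, however small or large its values are, and
  \<open>\<beta>\<close> is integrable over sets with compact closure.

  The same inequality \<open>(- ln s) powr (- \<alpha> x) \<le> 1\<close> gives condition (1): the integrand is at
  most \<open>\<beta> x\<close> for \<open>s < \<epsilon>\<close> and at most \<open>g x s / s\<close> for \<open>s \<ge> \<epsilon>\<close>, and Tonelli's theorem
  applies.

  The measurability of the supremum over the uncountable interval comes from the continuity
  of the derivative, which reduces it to a countable supremum
  (\<open>borel_measurable_SUP_interval\<close>).
\<close>

section \<open>Calculus of negative powers of the logarithm\<close>

lemma has_real_derivative_powr_neg_ln:
  fixes a c s :: real
  assumes "0 < c" "0 < s" "c * s < 1"
  shows "((\<lambda>s. (- ln (c * s)) powr (- a)) has_real_derivative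
           a * (- ln (c * s)) powr (- a - 1) / s) (at s)"
proof -
  have "ln (c * s) < 0"
    using assms by simp
  then show ?thesis
    using assms by (auto intro!: derivative_eq_intros simp: field_simps)
qed

text \<open>
  The value depends on \<open>c\<close> and \<open>b\<close> only through \<open>c * b\<close>, because \<open>ds / s\<close> is invariant under
  dilations. The factor \<open>c\<close> is carried along since the integrand is needed at \<open>n * s\<close>.
\<close>

lemma nn_integral_powr_neg_ln:
  fixes a b c :: real
  assumes a: "0 < a" and "0 < c" "0 < b" "c * b < 1"
  shows "(\<integral>\<^sup>+s\<in>{0<..<b}. ennreal (a * (- ln (c * s)) powr (- a - 1) / s) \<partial>lborel)
           = ennreal ((- ln (c * b)) powr (- a))"
proof -
  let ?F = "\<lambda>s. (- ln (c * s)) powr (- a)"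
  let ?f = "\<lambda>s. a * (- ln (c * s)) powr (- a - 1) / s"
  have cs: "c * s < 1" if "s < b" for s
    using assms that by (meson less_trans mult_strict_left_mono)
  have D: "DERIV ?F s :> ?f s" if "0 < ereal s" "ereal s < ereal b" for s
    using that assms cs by (intro has_real_derivative_powr_neg_ln) auto
  have ct: "isCont ?f s" if "0 < ereal s" "ereal s < ereal b" for s
    using that assms cs[of s] ln_less_zero[of "c * s"] by (intro continuous_intros) auto
  have lim0: "((\<lambda>s. ?F s) \<longlongrightarrow> 0) (at_right 0)"
  proof -
    have "filterlim (\<lambda>s. c * s) (at_right 0) (at_right 0)"
      using \<open>0 < c\<close> by (auto simp: filterlim_at eventually_at_filter intro!: tendsto_eq_intros)
    then have "filterlim (\<lambda>s. - ln (c * s)) at_top (at_right 0)"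
      using filterlim_compose[OF ln_at_0] by (simp add: filterlim_uminus_at_top)
    then show ?thesis
      using a by (intro tendsto_neg_powr) auto
  qed
  have limb: "(?F \<longlongrightarrow> ?F b) (at_left b)"
    using assms ln_less_zero[of "c * b"] by (intro tendsto_intros) auto
  have A: "((?F \<circ> real_of_ereal) \<longlongrightarrow> 0) (at_right 0)"
    using lim0 by (simp add: ereal_tendsto_simps zero_ereal_def)
  have B: "((?F \<circ> real_of_ereal) \<longlongrightarrow> ?F b) (at_left (ereal b))"
    using limb by (simp add: ereal_tendsto_simps)
  have nonneg: "AE s in lborel. 0 < ereal s \<longrightarrow> ereal s < ereal b \<longrightarrow> 0 \<le> ?f s"
    using a by auto
  note FTC = interval_integral_FTC_nonneg[OF _ D ct nonneg A B]
  have I: "set_integrable lborel {0<..<b} ?f"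
    using FTC(1) assms by (simp add: zero_ereal_def)
  have "(LBINT s=0..ereal b. ?f s) = ?F b"
    using FTC(2) assms by simp
  then have E: "(LBINT s:{0<..<b}. ?f s) = ?F b"
    using assms by (simp add: interval_lebesgue_integral_def zero_ereal_def)
  have "(\<integral>\<^sup>+s\<in>{0<..<b}. ennreal (?f s) \<partial>lborel) = (\<integral>\<^sup>+s. ennreal (indicator {0<..<b} s *\<^sub>R ?f s) \<partial>lborel)"
    by (intro nn_integral_cong) (auto simp: indicator_def)
  also have "\<dots> = ennreal (LBINT s:{0<..<b}. ?f s)"
    unfolding set_lebesgue_integral_def
    using I a by (intro nn_integral_eq_integral) (auto simp: set_integrable_def indicator_def)
  finally show ?thesis
    by (simp add: E)
qed

text \<open>
  The function \<open>(- ln u) powr (- a - 1) / u\<close> need not be monotone on \<open>(0, 1)\<close>, so its maximum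
  over the interval is not taken at a fixed endpoint; the two factors are bounded at
  opposite endpoints instead, at the price of the constant \<open>n\<close>.
\<close>

lemma powr_neg_ln_dilation_bound:
  fixes a n s u :: real
  assumes "0 < a" "1 \<le> n" "0 < s" "n * s < 1" and u: "u \<in> {s / n..s * n}"
  shows "a * (- ln u) powr (- a - 1) / u \<le> n * (a * (- ln (n * s)) powr (- a - 1) / s)"
proof -
  have "0 < s / n"
    using assms by simp
  then have "0 < u"
    using u by (auto simp del: zero_less_divide_iff)
  have "(- ln u) powr (- a - 1) \<le> (- ln (n * s)) powr (- a - 1)"
    using assms \<open>0 < u\<close> ln_less_zero[of "n * s"]
    by (intro powr_mono2') (auto simp: mult.commute)
  moreover have "1 / u \<le> n / s"
    using u assms \<open>0 < u\<close> by (auto simp: field_simps)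
  ultimately have "(- ln u) powr (- a - 1) * (1 / u) \<le> (- ln (n * s)) powr (- a - 1) * (n / s)"
    using \<open>0 < u\<close> by (intro mult_mono) auto
  from mult_left_mono[OF this, of a] show ?thesis
    using assms by (simp add: mult_ac)
qed

section \<open>Measurability\<close>

text \<open>
  The supremum over an interval with moving endpoints is turned into a supremum over a
  fixed countable set: the interval is parametrised by \<open>t \<in> {0..1}\<close>, and by continuity
  the rational parameters suffice.
\<close>

lemma borel_measurable_SUP_interval:
  fixes h :: "'b \<Rightarrow> real \<Rightarrow> ennreal" and p q :: "'b \<Rightarrow> real"
  assumes h [measurable]: "(\<lambda>(x, u). h x u) \<in> borel_measurable (M \<Otimes>\<^sub>M borel)"
    and [measurable]: "p \<in> borel_measurable M" "q \<in> borel_measurable M"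
    and le: "\<And>x. x \<in> space M \<Longrightarrow> p x \<le> q x"
    and cont: "\<And>x. x \<in> space M \<Longrightarrow> continuous_on {p x..q x} (h x)"
  shows "(\<lambda>x. SUP u\<in>{p x..q x}. h x u) \<in> borel_measurable M"
proof -
  let ?k = "\<lambda>x t. p x + t * (q x - p x)"
  let ?R = "{0..1} \<inter> \<rat> :: real set"
  have clR: "closure ?R = {0..1}"
    using closure_convex_Int_superset[of "{0..1::real}" \<rat>] by (simp add: Rats_closure_real)
  have eq: "(SUP u\<in>{p x..q x}. h x u) = (SUP t\<in>?R. h x (?k x t))" if x: "x \<in> space M" for x
  proof (rule antisym)
    have img: "?k x ` {0..1} = {p x..q x}"
    proof -
      have "?k x ` {0..1} = (\<lambda>t. t * (q x - p x) + p x) ` {0..1}"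
        by (intro image_cong) auto
      also have "\<dots> = {p x..q x}"
        using le[OF x] image_affinity_atLeastAtMost[of "q x - p x" "p x" 0 1]
        by (simp add: mult.commute)
      finally show ?thesis .
    qed
    have "continuous_on {0..1} (\<lambda>t. h x (?k x t))"
      by (rule continuous_on_compose2[OF cont[OF x]]) (use img in \<open>auto intro!: continuous_intros\<close>)
    then have "(\<lambda>t. h x (?k x t)) ` closure ?R \<subseteq> {..SUP t\<in>?R. h x (?k x t)}"
      by (intro image_closure_subset) (auto simp: clR intro: SUP_upper)
    then have "h x (?k x t) \<le> (SUP t\<in>?R. h x (?k x t))" if "t \<in> {0..1}" for t
      using that unfolding clR by blast
    then show "(SUP u\<in>{p x..q x}. h x u) \<le> (SUP t\<in>?R. h x (?k x t))"
      unfolding img[symmetric] by (auto intro!: SUP_least)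
    show "(SUP t\<in>?R. h x (?k x t)) \<le> (SUP u\<in>{p x..q x}. h x u)"
      using img by (intro SUP_mono) blast
  qed
  have "(\<lambda>x. SUP t\<in>?R. h x (?k x t)) \<in> borel_measurable M"
  proof (rule borel_measurable_SUP)
    show "countable ?R"
      by (auto intro: countable_rat)
    fix t
    have "(\<lambda>x. (\<lambda>(x, u). h x u) (x, ?k x t)) \<in> borel_measurable M"
      by measurable
    then show "(\<lambda>x. h x (?k x t)) \<in> borel_measurable M"
      by simp
  qed
  then show ?thesis
    by (subst measurable_cong[OF eq])
qed

lemma borel_measurable_restrict_space_Times:
  fixes f :: "'a::second_countable_topology \<Rightarrow> real" and I :: "real set"
  assumes "f \<in> borel_measurable (restrict_space borel Y)"
  shows "(\<lambda>p. f (fst p)) \<in> borel_measurable (restrict_space borel (Y \<times> I))"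
  by (rule measurable_compose[OF measurable_restrict_space3 assms])
     (auto simp: borel_prod[symmetric])

lemma borel_measurable_mult_neg_ln_powr:
  fixes Y :: "'a::second_countable_topology set" and I :: "real set"
  assumes "\<alpha> \<in> borel_measurable (restrict_space borel Y)"
    and "\<beta> \<in> borel_measurable (restrict_space borel Y)"
  shows "(\<lambda>(x, s). \<beta> x * (- ln s) powr (- \<alpha> x)) \<in> borel_measurable (restrict_space borel (Y \<times> I))"
proof -
  have [measurable]: "snd \<in> borel_measurable (restrict_space (borel :: ('a \<times> real) measure) (Y \<times> I))"
    by (intro measurable_restrict_space1) (simp add: borel_prod[symmetric])
  note [measurable] = assms[THEN borel_measurable_restrict_space_Times]
  show ?thesis
    unfolding case_prod_beta by measurable
qed

lemma borel_measurable_times_indicator_subset: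
  fixes f :: "'b \<Rightarrow> ennreal"
  assumes "f \<in> borel_measurable (restrict_space M Y)" "A \<in> sets M" "A \<subseteq> Y"
  shows "(\<lambda>x. f x * indicator A x) \<in> borel_measurable M"
  using measurable_restrict_mono[OF assms(1,3)] assms(2)
  by (simp add: borel_measurable_restrict_space_iff_ennreal)

lemma borel_measurable_l_fun:
  fixes Y :: "'a::second_countable_topology set"
  assumes Y: "Y \<in> sets borel"
    and "\<alpha> \<in> borel_measurable (restrict_space borel Y)"
    and "\<beta> \<in> borel_measurable (restrict_space borel Y)"
    and g: "(\<lambda>(x, s). g x s) \<in> borel_measurable (restrict_space borel (Y \<times> {\<epsilon>..}))"
  shows "(\<lambda>(x, s). l_fun Y \<alpha> \<beta> \<epsilon> g x s) \<in> borel_measurable borel"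
proof -
  let ?f = "\<lambda>(x, s). \<beta> x * (- ln s) powr (- \<alpha> x)"
  have S: "Y \<times> {\<epsilon>..} \<in> sets borel" "Y \<times> {0<..<\<epsilon>} \<in> sets borel"
    using Y by (auto simp: borel_prod[symmetric])
  have "(\<lambda>p. indicator (Y \<times> {0<..<\<epsilon>}) p *\<^sub>R ?f p) \<in> borel_measurable borel"
    using borel_measurable_mult_neg_ln_powr[OF assms(2,3), of "{0<..<\<epsilon>}"] S
    by (subst borel_measurable_restrict_space_iff[symmetric]) simp_all
  moreover have "(\<lambda>p. indicator (Y \<times> {\<epsilon>..}) p *\<^sub>R (\<lambda>(x, s). g x s) p) \<in> borel_measurable borel"
    using g S by (subst borel_measurable_restrict_space_iff[symmetric]) simp_all
  ultimately have "(\<lambda>p. indicator (Y \<times> {0<..<\<epsilon>}) p *\<^sub>R ?f p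
      + indicator (Y \<times> {\<epsilon>..}) p *\<^sub>R (\<lambda>(x, s). g x s) p) \<in> borel_measurable borel"
    by (rule borel_measurable_add)
  also have "(\<lambda>p. indicator (Y \<times> {0<..<\<epsilon>}) p *\<^sub>R ?f p
      + indicator (Y \<times> {\<epsilon>..}) p *\<^sub>R (\<lambda>(x, s). g x s) p) = (\<lambda>(x, s). l_fun Y \<alpha> \<beta> \<epsilon> g x s)"
    by (auto simp: l_fun_def fun_eq_iff)
  finally show ?thesis .
qed

text \<open>
  Borel functions are measurable for the reference measure, although its second factor
  lives on \<open>(0, \<infinity>)\<close> only.
\<close>

lemma measurable_reference_measure_ident:
  fixes \<sigma> :: "'a::second_countable_topology measure"
  assumes "sets \<sigma> = sets borel"
  shows "(\<lambda>p. p) \<in> measurable (reference_measure \<sigma>) borel"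
proof -
  have "(\<lambda>p. (fst p, snd p)) \<in> measurable (\<sigma> \<Otimes>\<^sub>M restrict_space lborel {0::real<..}) (borel \<Otimes>\<^sub>M borel)"
  proof (rule measurable_Pair)
    show "fst \<in> measurable (\<sigma> \<Otimes>\<^sub>M restrict_space lborel {0::real<..}) borel"
      by (rule measurable_compose[OF measurable_fst measurable_ident_sets[OF assms]])
    have "(\<lambda>s. s) \<in> measurable (restrict_space lborel {0::real<..}) (borel :: real measure)"
      by (intro measurable_restrict_space1) simp
    from measurable_compose[OF measurable_snd[of \<sigma>] this]
    show "snd \<in> measurable (\<sigma> \<Otimes>\<^sub>M restrict_space lborel {0::real<..}) borel" .
  qed
  then show ?thesis
    by (simp add: reference_measure_def borel_prod)
qed

lemma nn_integral_reference_measure: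
  fixes \<sigma> :: "'a::second_countable_topology measure"
  assumes \<sigma>: "sets \<sigma> = sets borel" and f: "f \<in> borel_measurable borel"
  shows "(\<integral>\<^sup>+p. f p \<partial>reference_measure \<sigma>)
           = (\<integral>\<^sup>+x. (\<integral>\<^sup>+s\<in>{0<..}. f (x, s) \<partial>lborel) \<partial>\<sigma>)"
proof -
  interpret S: sigma_finite_measure "restrict_space lborel {0<..} :: real measure"
    by (intro sigma_finite_measure_restrict_space) (auto intro: lborel.sigma_finite_measure_axioms)
  have "f \<in> borel_measurable (\<sigma> \<Otimes>\<^sub>M restrict_space lborel {0<..})"
    using measurable_compose[OF measurable_reference_measure_ident[OF \<sigma>] f]
    by (simp add: reference_measure_def)
  from S.nn_integral_fst[OF this] show ?thesis
    by (simp add: reference_measure_def nn_integral_restrict_space)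
qed

section \<open>The two conditions\<close>

text \<open>
  Below \<open>\<epsilon>\<close> the integrand is dominated by \<open>\<beta> x\<close>, on an interval of finite length; above
  \<open>\<epsilon>\<close> it is dominated by \<open>g x s / s\<close>.
\<close>

lemma condition1_l_fun:
  fixes \<sigma> :: "'a::second_countable_topology measure"
  assumes \<sigma>: "sets \<sigma> = sets borel"
    and \<alpha>_pos: "\<And>x. x \<in> Y \<Longrightarrow> 0 < \<alpha> x"
    and \<beta>: "\<beta> \<in> L1_loc Y \<sigma>" and \<beta>_pos: "\<And>x. x \<in> Y \<Longrightarrow> 0 < \<beta> x"
    and \<epsilon>: "0 < \<epsilon>" "\<epsilon> < exp (-1)"
    and g: "(\<lambda>(x, s). g x s) \<in> borel_measurable (restrict_space borel (Y \<times> {\<epsilon>..}))"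
    and g_pos: "\<And>x s. x \<in> Y \<Longrightarrow> \<epsilon> \<le> s \<Longrightarrow> 0 < g x s"
    and g_int: "\<And>A. A \<in> Borel0 Y \<Longrightarrow>
           (\<integral>\<^sup>+x\<in>A. (\<integral>\<^sup>+s\<in>{\<epsilon>..}. ennreal (g x s / s) \<partial>lborel) \<partial>\<sigma>) < \<infinity>"
  shows "condition1 \<sigma> Y (l_fun Y \<alpha> \<beta> \<epsilon> g)"
proof -
  let ?l = "l_fun Y \<alpha> \<beta> \<epsilon> g"
  have ln_gt: "1 < - ln s" if "0 < s" "s < \<epsilon>" for s
    using that \<epsilon> ln_less_cancel_iff[of s "exp (-1)"] by auto
  have pos: "0 < ?l x s" if "x \<in> Y" "0 < s" for x s
    using that \<beta>_pos[of x] g_pos[of x s] ln_gt[of s] by (auto simp: l_fun_def intro!: mult_pos_pos)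
  have zero: "?l x s = 0" if "x \<notin> Y" for x s
    using that by (simp add: l_fun_def)
  have small: "?l x s \<le> \<beta> x" if "x \<in> Y" "0 < s" "s < \<epsilon>" for x s
  proof -
    have "(- ln s) powr (- \<alpha> x) \<le> (- ln s) powr 0"
      using that ln_gt[of s] \<alpha>_pos[of x] by (intro powr_mono) auto
    then have "\<beta> x * (- ln s) powr (- \<alpha> x) \<le> \<beta> x"
      using that \<beta>_pos[of x] ln_gt[of s] mult_left_le[of "(- ln s) powr (- \<alpha> x)" "\<beta> x"]
      by (auto split: if_splits)
    then show ?thesis
      using that by (simp add: l_fun_def)
  qed
  have fin: "(\<integral>\<^sup>+p\<in>A \<times> {0<..}. ennreal (?l (fst p) (snd p) * min (1 / snd p) 1)
               \<partial>reference_measure \<sigma>) < \<infinity>" if A: "A \<in> Borel0 Y" for A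
  proof -
    have AY: "A \<subseteq> Y" and Ab [measurable]: "A \<in> sets borel"
      using A by (auto simp: Borel0_def)
    let ?b = "\<lambda>x. ennreal \<bar>\<beta> x\<bar> * indicator A x"
    let ?u = "\<lambda>p. ?b (fst p) * indicator {0<..<\<epsilon>} (snd p)"
    let ?v = "\<lambda>p. ennreal (g (fst p) (snd p) / snd p) * indicator (A \<times> {\<epsilon>..}) p"
    have b [measurable]: "?b \<in> borel_measurable borel"
    proof (rule borel_measurable_times_indicator_subset[OF _ Ab AY])
      have [measurable]: "\<beta> \<in> borel_measurable (restrict_space borel Y)"
        using \<beta> by (simp add: L1_loc_def)
      show "(\<lambda>x. ennreal \<bar>\<beta> x\<bar>) \<in> borel_measurable (restrict_space borel Y)"
        by measurable
    qed
    have u: "?u \<in> borel_measurable borel"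
      unfolding borel_prod[symmetric] by measurable
    have "snd \<in> borel_measurable (restrict_space (borel :: ('a \<times> real) measure) (Y \<times> {\<epsilon>..}))"
      by (intro measurable_restrict_space1) (simp add: borel_prod[symmetric])
    with g have "(\<lambda>p. ennreal (g (fst p) (snd p) / snd p))
        \<in> borel_measurable (restrict_space borel (Y \<times> {\<epsilon>..}))"
      unfolding case_prod_beta by measurable
    then have v: "?v \<in> borel_measurable borel"
      by (rule borel_measurable_times_indicator_subset) (use AY in \<open>auto simp: borel_prod[symmetric]\<close>)
    have "(\<integral>\<^sup>+p\<in>A \<times> {0<..}. ennreal (?l (fst p) (snd p) * min (1 / snd p) 1)
               \<partial>reference_measure \<sigma>) \<le> (\<integral>\<^sup>+p. ?u p + ?v p \<partial>reference_measure \<sigma>)"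
    proof (rule nn_integral_mono)
      fix p :: "'a \<times> real"
      obtain x s where p: "p = (x, s)" by (cases p)
      show "ennreal (?l (fst p) (snd p) * min (1 / snd p) 1) * indicator (A \<times> {0<..}) p
              \<le> ?u p + ?v p"
      proof (cases "x \<in> A \<and> 0 < s")
        case True
        then have xY: "x \<in> Y" using AY by auto
        show ?thesis
        proof (cases "s < \<epsilon>")
          case True
          then have "?l x s * min (1 / s) 1 \<le> \<beta> x * 1"
            using small[OF xY] pos[OF xY] \<open>x \<in> A \<and> 0 < s\<close> \<beta>_pos[OF xY]
            by (intro mult_mono) (auto simp: less_imp_le)
          then show ?thesis
            using True \<open>x \<in> A \<and> 0 < s\<close> \<beta>_pos[OF xY] by (auto simp: p intro!: ennreal_leI)
        next
          case False
          then have "?l x s * min (1 / s) 1 \<le> g x s * (1 / s)"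
            using g_pos[OF xY, of s] xY \<open>x \<in> A \<and> 0 < s\<close> by (intro mult_mono) (auto simp: l_fun_def)
          then show ?thesis
            using False \<open>x \<in> A \<and> 0 < s\<close> by (auto simp: p intro!: ennreal_leI)
        qed
      next
        case False
        then show ?thesis by (auto simp: p)
      qed
    qed
    also have "\<dots> = (\<integral>\<^sup>+p. ?u p \<partial>reference_measure \<sigma>) + (\<integral>\<^sup>+p. ?v p \<partial>reference_measure \<sigma>)"
      using u v measurable_compose[OF measurable_reference_measure_ident[OF \<sigma>]]
      by (intro nn_integral_add) auto
    also have "\<dots> < \<infinity>"
    proof -
      have "(\<integral>\<^sup>+p. ?u p \<partial>reference_measure \<sigma>)
              = (\<integral>\<^sup>+x. ?b x * (\<integral>\<^sup>+s. indicator {0<..<\<epsilon>} s \<partial>lborel) \<partial>\<sigma>)"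
        unfolding nn_integral_reference_measure[OF \<sigma> u]
      proof (intro nn_integral_cong)
        fix x
        have "(\<integral>\<^sup>+s\<in>{0<..}. ?u (x, s) \<partial>lborel) = (\<integral>\<^sup>+s. ?b x * indicator {0<..<\<epsilon>} s \<partial>lborel)"
          by (intro nn_integral_cong) (auto simp: indicator_def)
        then show "(\<integral>\<^sup>+s\<in>{0<..}. ?u (x, s) \<partial>lborel)
                     = ?b x * (\<integral>\<^sup>+s. indicator {0<..<\<epsilon>} s \<partial>lborel)"
          by (simp add: nn_integral_cmult)
      qed
      also have "\<dots> = (\<integral>\<^sup>+x. ?b x \<partial>\<sigma>) * ennreal \<epsilon>"
        using b \<epsilon> by (subst nn_integral_multc) (auto simp: measurable_cong_sets[OF \<sigma> refl])
      also have "\<dots> < \<infinity>"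
        using \<beta> A by (auto simp: L1_loc_def ennreal_mult_less_top)
      finally have U: "(\<integral>\<^sup>+p. ?u p \<partial>reference_measure \<sigma>) < \<infinity>" .
      have "(\<integral>\<^sup>+p. ?v p \<partial>reference_measure \<sigma>)
              = (\<integral>\<^sup>+x\<in>A. (\<integral>\<^sup>+s\<in>{\<epsilon>..}. ennreal (g x s / s) \<partial>lborel) \<partial>\<sigma>)"
        unfolding nn_integral_reference_measure[OF \<sigma> v]
      proof (intro nn_integral_cong)
        fix x
        have "(\<integral>\<^sup>+s\<in>{0<..}. ?v (x, s) \<partial>lborel)
                = (if x \<in> A then (\<integral>\<^sup>+s\<in>{\<epsilon>..}. ennreal (g x s / s) \<partial>lborel) else 0)"
          using \<epsilon> by (auto intro!: nn_integral_cong simp: indicator_def)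
        then show "(\<integral>\<^sup>+s\<in>{0<..}. ?v (x, s) \<partial>lborel)
                = (\<integral>\<^sup>+s\<in>{\<epsilon>..}. ennreal (g x s / s) \<partial>lborel) * indicator A x"
          by simp
      qed
      then show ?thesis
        using U g_int[OF A] by (simp add: less_top)
    qed
    finally show ?thesis .
  qed
  show ?thesis
    unfolding condition1_def
  proof (intro conjI allI ballI)
    fix x
    show "(\<forall>s>0. ?l x s > 0) \<or> (\<forall>s>0. ?l x s = 0)"
      using pos zero by (cases "x \<in> Y") auto
    show "(\<forall>s>0. ?l x s > 0) \<longleftrightarrow> x \<in> Y"
    proof
      assume "\<forall>s>0. ?l x s > 0"
      then have "?l x 1 > 0" by simp
      then show "x \<in> Y" using zero[of x 1] by (cases "x \<in> Y") simp_all
    qed (use pos in blast)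
  qed (rule fin)
qed

text \<open>
  The decomposition is \<open>\<epsilon>' = \<epsilon>\<close> and \<open>l2 = 0\<close>. The function \<open>l1\<close> is given by the formula for
  \<open>l\<close> near \<open>0\<close>, continued beyond \<open>\<epsilon>\<close>, so that its derivative is known on all of \<open>(0, 1)\<close>.
\<close>

lemma condition2_l_fun:
  fixes \<sigma> :: "'a::second_countable_topology measure"
  assumes \<sigma>: "sets \<sigma> = sets borel"
    and \<alpha>: "\<alpha> \<in> borel_measurable (restrict_space borel Y)"
    and \<alpha>_pos: "\<And>x. x \<in> Y \<Longrightarrow> 0 < \<alpha> x"
    and \<beta>: "\<beta> \<in> L1_loc Y \<sigma>" and \<beta>_pos: "\<And>x. x \<in> Y \<Longrightarrow> 0 < \<beta> x"
    and \<epsilon>: "0 < \<epsilon>" "\<epsilon> < exp (-1)"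
  shows "condition2 \<sigma> Y (l_fun Y \<alpha> \<beta> \<epsilon> g)"
proof -
  let ?l1 = "\<lambda>x s. \<beta> x * (- ln s) powr (- \<alpha> x)"
  let ?d = "\<lambda>x u. \<beta> x * (\<alpha> x * (- ln u) powr (- \<alpha> x - 1) / u)"
  have "\<epsilon> < 1"
    using \<epsilon> by (smt (verit) exp_less_one_iff)
  have ln_eps: "1 < - ln \<epsilon>"
    using \<epsilon> ln_less_cancel_iff[of \<epsilon> "exp (-1)"] by auto
  have D: "(?l1 x has_real_derivative ?d x u) (at u)" if "0 < u" "u < 1" for x u
    using DERIV_cmult[OF has_real_derivative_powr_neg_ln[of 1 u "\<alpha> x"], of "\<beta> x"] that by simp
  have \<beta>m: "\<beta> \<in> borel_measurable (restrict_space borel Y)"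
    using \<beta> by (simp add: L1_loc_def)
  have [measurable]: "snd \<in> borel_measurable (restrict_space (borel :: ('a \<times> real) measure) (Y \<times> I))"
    for I :: "real set"
    by (intro measurable_restrict_space1) (simp add: borel_prod[symmetric])
  note [measurable] = \<alpha>[THEN borel_measurable_restrict_space_Times] \<beta>m[THEN borel_measurable_restrict_space_Times]
  \<comment> \<open>The choice \<open>s < \<epsilon> / n\<close> keeps the whole interval of the supremum inside \<open>(0, 1)\<close>,
    where the derivative has the closed form.\<close>
  have dilate: "s / real n > 0" "u \<in> {s / real n..s * real n} \<Longrightarrow> 0 < u \<and> u < 1"
      "real n * s < \<epsilon>" if "n \<ge> 1" "s \<in> {0<..<\<epsilon> / real n}" for n :: nat and s u
  proof -
    show 1: "s / real n > 0" using that by simp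
    show 2: "real n * s < \<epsilon>" using that by (simp add: field_simps)
    show "u \<in> {s / real n..s * real n} \<Longrightarrow> 0 < u \<and> u < 1"
      using 1 2 \<open>\<epsilon> < 1\<close> by (auto simp: mult.commute simp del: zero_less_divide_iff)
  qed
  have SUP_eq: "(SUP u\<in>{s / real n..s * real n}. ennreal \<bar>deriv (?l1 x) u\<bar>)
      = (SUP u\<in>{s / real n..s * real n}. ennreal \<bar>?d x u\<bar>)"
    if "n \<ge> 1" "s \<in> {0<..<\<epsilon> / real n}" for n :: nat and x s
    using dilate(2)[OF that] DERIV_imp_deriv[OF D] by (intro SUP_cong) auto
  have SUP_meas: "(\<lambda>(x, s). SUP u\<in>{s / real n..s * real n}. ennreal \<bar>deriv (?l1 x) u\<bar>)
      \<in> borel_measurable (restrict_space borel (Y \<times> {0<..<\<epsilon> / real n}))" (is "_ \<in> borel_measurable ?M")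
    if n: "n \<ge> 1" for n :: nat
  proof -
    have sp: "space ?M = Y \<times> {0<..<\<epsilon> / real n}"
      by (simp add: space_restrict_space)
    have "(\<lambda>p. SUP u\<in>{snd p / real n..snd p * real n}. ennreal \<bar>?d (fst p) u\<bar>) \<in> borel_measurable ?M"
    proof (rule borel_measurable_SUP_interval)
      show "(\<lambda>(p, u). ennreal \<bar>?d (fst p) u\<bar>) \<in> borel_measurable (?M \<Otimes>\<^sub>M borel)"
        unfolding case_prod_beta by measurable
      fix p assume p: "p \<in> space ?M"
      then have s: "snd p \<in> {0<..<\<epsilon> / real n}" by (auto simp: sp)
      have "snd p * 1 \<le> snd p * (real n * real n)"
        using n s by (intro mult_left_mono) (auto simp flip: of_nat_mult)
      then show "snd p / real n \<le> snd p * real n"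
        using n by (simp add: field_simps)
      have "continuous_on {snd p / real n..snd p * real n} (?d (fst p))"
      proof (intro continuous_intros ballI)
        fix u assume "u \<in> {snd p / real n..snd p * real n}"
        from dilate(2)[OF n s this] show "u \<noteq> 0" "u \<noteq> 0" "- ln u \<noteq> 0" by auto
      qed
      then show "continuous_on {snd p / real n..snd p * real n} (\<lambda>u. ennreal \<bar>?d (fst p) u\<bar>)"
        by (intro continuous_on_ennreal continuous_on_rabs)
    qed measurable
    then show ?thesis
      by (subst measurable_cong[where g = "\<lambda>p. SUP u\<in>{snd p / real n..snd p * real n}. ennreal \<bar>?d (fst p) u\<bar>"])
         (use SUP_eq[OF n] sp in auto)
  qed
  have inner: "(\<integral>\<^sup>+s\<in>{0<..<\<epsilon> / real n}.
      (SUP u\<in>{s / real n..s * real n}. ennreal \<bar>deriv (?l1 x) u\<bar>) \<partial>lborel)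
        \<le> ennreal (real n) * ennreal \<bar>\<beta> x\<bar>" if n: "n \<ge> 1" and x: "x \<in> Y" for n :: nat and x
  proof -
    let ?f = "\<lambda>s. \<alpha> x * (- ln (real n * s)) powr (- \<alpha> x - 1) / s"
    note pos = \<alpha>_pos[OF x] \<beta>_pos[OF x]
    have "(SUP u\<in>{s / real n..s * real n}. ennreal \<bar>deriv (?l1 x) u\<bar>)
            \<le> ennreal (real n * \<beta> x) * ennreal (?f s)" if s: "s \<in> {0<..<\<epsilon> / real n}" for s
      unfolding SUP_eq[OF n s]
    proof (rule SUP_least)
      fix u assume u: "u \<in> {s / real n..s * real n}"
      have "\<bar>?d x u\<bar> = ?d x u"
        using dilate(2)[OF n s u] pos by simp
      also have "\<dots> \<le> \<beta> x * (real n * ?f s)"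
        using n s u pos dilate(3)[OF n s] \<open>\<epsilon> < 1\<close>
        by (intro mult_left_mono powr_neg_ln_dilation_bound) auto
      finally have "ennreal \<bar>?d x u\<bar> \<le> ennreal ((real n * \<beta> x) * ?f s)"
        by (intro ennreal_leI) (simp add: mult_ac)
      then show "ennreal \<bar>?d x u\<bar> \<le> ennreal (real n * \<beta> x) * ennreal (?f s)"
        using pos s by (subst ennreal_mult[symmetric]) auto
    qed
    then have "(\<integral>\<^sup>+s\<in>{0<..<\<epsilon> / real n}.
          (SUP u\<in>{s / real n..s * real n}. ennreal \<bar>deriv (?l1 x) u\<bar>) \<partial>lborel)
        \<le> (\<integral>\<^sup>+s. ennreal (real n * \<beta> x) * (ennreal (?f s) * indicator {0<..<\<epsilon> / real n} s) \<partial>lborel)"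
      by (intro nn_integral_mono) (auto simp: indicator_def)
    also have "\<dots> = ennreal (real n * \<beta> x) * ennreal ((- ln \<epsilon>) powr (- \<alpha> x))"
      using nn_integral_powr_neg_ln[of "\<alpha> x" "real n" "\<epsilon> / real n"] n pos \<epsilon> \<open>\<epsilon> < 1\<close>
      by (subst nn_integral_cmult) auto
    \<comment> \<open>Here \<open>- ln \<epsilon> > 1\<close> removes the dependence on \<open>\<alpha> x\<close>.\<close>
    also have "\<dots> \<le> ennreal (real n * \<beta> x) * 1"
    proof -
      have "(- ln \<epsilon>) powr (- \<alpha> x) \<le> (- ln \<epsilon>) powr 0"
        using ln_eps pos by (intro powr_mono) auto
      then show ?thesis
        using ln_eps by (intro mult_left_mono) auto
    qed
    finally show ?thesis
      using pos by (simp add: ennreal_mult)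
  qed
  have outer: "(\<integral>\<^sup>+x\<in>A. (\<integral>\<^sup>+s\<in>{0<..<\<epsilon> / real n}.
      (SUP u\<in>{s / real n..s * real n}. ennreal \<bar>deriv (?l1 x) u\<bar>) \<partial>lborel) \<partial>\<sigma>) < \<infinity>"
    if n: "n \<ge> 1" and A: "A \<in> Borel0 Y" for n :: nat and A
  proof -
    let ?b = "\<lambda>x. ennreal \<bar>\<beta> x\<bar> * indicator A x"
    have AY: "A \<subseteq> Y" and Ab [measurable]: "A \<in> sets borel"
      using A by (auto simp: Borel0_def)
    have b: "?b \<in> borel_measurable \<sigma>"
      using borel_measurable_times_indicator_subset[OF _ Ab AY] \<beta>m
      by (simp add: measurable_cong_sets[OF \<sigma> refl])
    have "(\<integral>\<^sup>+x\<in>A. (\<integral>\<^sup>+s\<in>{0<..<\<epsilon> / real n}.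
        (SUP u\<in>{s / real n..s * real n}. ennreal \<bar>deriv (?l1 x) u\<bar>) \<partial>lborel) \<partial>\<sigma>)
        \<le> (\<integral>\<^sup>+x. ennreal (real n) * ?b x \<partial>\<sigma>)"
      using inner[OF n] AY by (intro nn_integral_mono) (auto simp: indicator_def)
    also have "\<dots> = ennreal (real n) * (\<integral>\<^sup>+x. ?b x \<partial>\<sigma>)"
      using b by (rule nn_integral_cmult)
    also have "\<dots> < \<infinity>"
      using \<beta> A by (auto simp: L1_loc_def ennreal_mult_less_top)
    finally show ?thesis .
  qed
  have diff: "?l1 x differentiable_on {0<..<\<epsilon>}" for x
    unfolding differentiable_on_def
  proof
    fix u assume "u \<in> {0<..<\<epsilon>}"
    with D[of u x] \<open>\<epsilon> < 1\<close> have "?l1 x differentiable (at u)"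
      unfolding real_differentiable_def by auto
    then show "?l1 x differentiable (at u within {0<..<\<epsilon>})"
      by (rule differentiable_at_withinI)
  qed
  show ?thesis
    unfolding condition2_def
  proof (rule exI[of _ \<epsilon>], rule conjI[OF \<epsilon>(1)],
      rule exI[of _ ?l1], rule exI[of _ "\<lambda>_ _. 0"], intro conjI allI impI)
    show "(\<lambda>(x, s). ?l1 x s) \<in> borel_measurable (restrict_space borel (Y \<times> {0<..<\<epsilon>}))"
      by (rule borel_measurable_mult_neg_ln_powr[OF \<alpha> \<beta>m])
    show "\<forall>x\<in>Y. \<forall>s\<in>{0<..<\<epsilon>}. l_fun Y \<alpha> \<beta> \<epsilon> g x s = ?l1 x s + 0"
      by (auto simp: l_fun_def)
  qed (use SUP_meas outer diff in auto)
qed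

theorem proposition25:
  fixes \<sigma> :: "'a::polish_space measure"
    and Y :: "'a set"
    and \<alpha> \<beta> :: "'a \<Rightarrow> real"
    and \<epsilon> :: real
    and g l :: "'a \<Rightarrow> real \<Rightarrow> real"
    and m :: "('a \<times> real) measure"
  assumes "locally_compact_space (euclidean :: 'a topology)"
    and "radon_measure \<sigma>"
    and "non_atomic \<sigma>"
    and "Y \<in> sets borel"
    and "\<alpha> \<in> borel_measurable (restrict_space borel Y)"
    and "\<And>x. x \<in> Y \<Longrightarrow> 0 < \<alpha> x"
    and "\<beta> \<in> L1_loc Y \<sigma>"
    and "\<And>x. x \<in> Y \<Longrightarrow> 0 < \<beta> x"
    and "0 < \<epsilon>" and "\<epsilon> < exp (-1)"
    and "(\<lambda>(x, s). g x s) \<in> borel_measurable (restrict_space borel (Y \<times> {\<epsilon>..}))"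
    and "\<And>x s. x \<in> Y \<Longrightarrow> \<epsilon> \<le> s \<Longrightarrow> 0 < g x s"
    and "\<And>A. A \<in> Borel0 Y \<Longrightarrow>
           (\<integral>\<^sup>+x\<in>A. (\<integral>\<^sup>+s\<in>{\<epsilon>..}. ennreal (g x s / s) \<partial>lborel) \<partial>\<sigma>) < \<infinity>"
    and "l = l_fun Y \<alpha> \<beta> \<epsilon> g"
    and "m = density (reference_measure \<sigma>) (\<lambda>(x, s). ennreal (l x s / s))"
  shows "has_levy_density \<sigma> m l \<and> condition1 \<sigma> Y l \<and> condition2 \<sigma> Y l"
proof -
  have \<sigma>: "sets \<sigma> = sets borel"
    using assms(2) by (simp add: radon_measure_def)
  have \<beta>: "\<beta> \<in> borel_measurable (restrict_space borel Y)"
    using assms(7) by (simp add: L1_loc_def)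
  have "(\<lambda>(x, s). l x s) \<in> borel_measurable (reference_measure \<sigma>)"
    unfolding assms(14)
    using measurable_compose[OF measurable_reference_measure_ident[OF \<sigma>]
        borel_measurable_l_fun[OF assms(4,5) \<beta> assms(11)]] .
  then have "has_levy_density \<sigma> m l"
    using assms(15) by (simp add: has_levy_density_def)
  moreover have "condition1 \<sigma> Y l"
    unfolding assms(14) using assms(6,8,12,13)
    by (intro condition1_l_fun[OF \<sigma> _ assms(7) _ assms(9,10,11)])
  moreover have "condition2 \<sigma> Y l"
    unfolding assms(14) using assms(6,8)
    by (intro condition2_l_fun[OF \<sigma> assms(5) _ assms(7) _ assms(9,10)])
  ultimately show ?thesis
    by blast
qed

end
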